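(* Let the integer $d=p^\varepsilon>1$ be a power of a prime $p$. Let $(b,c)$ be a vector of $\mathbb{Z}_d^2$. Denote by $U(b,c)\subset\mathbb{Z}_d^2$ the set-theoretic union of all points of the projective line $\mathbb{P}_1(\mathbb{Z}_d)$ containing the vector $(b,c)$. Then $U(b,c)$ is a generating set for the submodule $(b,c)^\perp\subset\mathbb{Z}_d^2$. Furthermore, the equality $$U(b,c)=(b,c)^\perp$$ holds if, and only if, one of the following conditions is satisfied: (a) $(b,c)=(0,0)$; (b) $(b,c)$ is an admissible pair.
   Context: $\mathbb{Z}_d$ denotes the ring of integers modulo $d$. Points: a vector (pair) $(x,y)\in\mathbb{Z}_d^2$ is called admissible if the map $\mathbb{Z}_d\to\mathbb{Z}_d^2$, $u\mapsto(ux,uy)$, is injective. A point of the projective line $\mathbb{P}_1(\mathbb{Z}_d)$ is a free cyclic submodule $\mathbb{Z}_d(x,y)=\{(ux,uy):u\in\mathbb{Z}_d\}$ with $(x,y)$ admissible, regarded as a set of vectors; $\mathbb{P}_1(\mathbb{Z}_d)$ is the set of all points. Perp-set: on $\mathbb{Z}_d^2$ let $[(b,c),(b',c')]:=cb'-c'b\in\mathbb{Z}_d$. Then $(b,c)^\perp:=\{(u,v)\in\mathbb{Z}_d^2:[(b,c),(u,v)]=0\}$, which is a $\mathbb{Z}_d$-submodule of $\mathbb{Z}_d^2$. *)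

theory Defs
  imports "Berlekamp_Zassenhaus.Finite_Field" "HOL-Library.Product_Plus"
begin

(* 'n mod_ring is the ring of integers modulo d = CARD('n); the sort nontriv says that d > 1. *)
type_synonym 'n zvec = "'n mod_ring \<times> 'n mod_ring"

definition zscale :: "'n::nontriv mod_ring \<Rightarrow> 'n zvec \<Rightarrow> 'n zvec" where
  "zscale u w = (u * fst w, u * snd w)"

(* Qualified, because HOL-Algebra has a locale called module as well.
   It makes available zmod.span, the submodule generated by a set of vectors. *)
interpretation zmod: Modules.module "zscale :: 'n::nontriv mod_ring \<Rightarrow> 'n zvec \<Rightarrow> 'n zvec"
  by unfold_locales (auto simp: zscale_def algebra_simps)

definition admissible :: "'n::nontriv zvec \<Rightarrow> bool" where
  "admissible w \<longleftrightarrow> inj (\<lambda>u. zscale u w)"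

definition cyclic_submodule :: "'n::nontriv zvec \<Rightarrow> 'n zvec set" where
  "cyclic_submodule w = {zscale u w | u. True}"

definition proj_line :: "'n::nontriv zvec set set" where
  "proj_line = {cyclic_submodule w | w. admissible w}"

definition sympl :: "'n::nontriv zvec \<Rightarrow> 'n zvec \<Rightarrow> 'n mod_ring" where
  "sympl v w = snd v * fst w - snd w * fst v"

definition perp :: "'n::nontriv zvec \<Rightarrow> 'n zvec set" where
  "perp v = {w. sympl v w = 0}"

definition point_union :: "'n::nontriv zvec \<Rightarrow> 'n zvec set" where
  "point_union v = \<Union>{P \<in> proj_line. v \<in> P}"

end

theory Submission
  imports Defs
begin

text \<open>Over \<open>\<int>/p\<^sup>\<epsilon>\<close> divisibility is a total preorder, so every vector \<open>v\<close> is a multiple \<open>r g\<close> of the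
  first member of a symplectic basis \<open>g, h\<close>. Then \<open>v\<^sup>\<bottom>\<close> consists of all \<open>\<alpha> g + \<beta> h\<close> with \<open>r \<beta> = 0\<close>, and
  for each such \<open>\<beta>\<close> both \<open>g\<close> and \<open>g + \<beta> h\<close> generate points through \<open>v\<close>; these span \<open>v\<^sup>\<bottom>\<close>.
  If \<open>r\<close> is a nonzero zero divisor, say \<open>r z = 0\<close> with \<open>z \<noteq> 0\<close>, then \<open>z h\<close> is in \<open>v\<^sup>\<bottom>\<close> but
  on no point through \<open>v\<close>, because one of the coordinates of the generator of such a point is a unit.\<close>

section \<open>Divisibility and units modulo \<open>d\<close>\<close>

lemma mod_ring_dvd_total:
  fixes a b :: "'n::nontriv mod_ring"
  assumes "prime p" and "CARD('n) = p ^ e"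
  shows "a dvd b \<or> b dvd a"
proof -
  have card0: "of_int (int (p ^ e)) = (0 :: 'n mod_ring)"
    using assms(2) by (metis of_int_of_nat_eq of_nat_card_eq_0)
  \<comment> \<open>Each residue is associated to a power of \<open>p\<close>, namely the gcd of an
    integer representative with \<open>p ^ e\<close>: since \<open>p ^ e\<close> vanishes in the
    ring, Bezout makes this gcd a multiple of \<open>a\<close>. Comparability then reduces to
    comparing exponents.\<close>
  have assoc: "\<exists>i. a dvd of_nat (p ^ i) \<and> of_nat (p ^ i) dvd a" for a :: "'n mod_ring"
  proof -
    obtain x where x: "a = of_int x"
      by (metis of_int_of_int_mod_ring of_int_mod_ring_to_int_mod_ring)
    define g where "g = nat (gcd x (int (p ^ e)))"
    have g: "int g = gcd x (int (p ^ e))" by (simp add: g_def)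
    have "int g dvd int (p ^ e)" using g by (metis gcd_dvd2)
    then obtain i where i: "g = p ^ i"
      using assms(1) divides_primepow_nat int_dvd_int_iff by metis
    obtain u v where "u * x + v * int (p ^ e) = gcd x (int (p ^ e))"
      using bezout_int by blast
    then have "of_int u * a = (of_int (int g) :: 'n mod_ring)"
      using card0 x g by (metis add.right_neutral mult_zero_right of_int_add of_int_mult)
    then have 1: "a dvd of_nat g" by (metis dvd_triv_right of_int_of_nat_eq)
    have "int g dvd x" using g by simp
    then obtain k where "x = int g * k" by blast
    then have "of_nat g dvd a" using x by simp
    with 1 i show ?thesis by blast
  qed
  obtain i j where ij: "a dvd of_nat (p ^ i)" "of_nat (p ^ i) dvd a"
     "b dvd of_nat (p ^ j)" "of_nat (p ^ j) dvd b"
    using assoc by metis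
  show ?thesis
  proof (cases "i \<le> j")
    case True
    then have "(of_nat (p ^ i) :: 'n mod_ring) dvd of_nat (p ^ j)"
      by (simp add: le_imp_power_dvd)
    then show ?thesis using ij by (metis dvd_trans)
  next
    case False
    then have "(of_nat (p ^ j) :: 'n mod_ring) dvd of_nat (p ^ i)"
      by (simp add: le_imp_power_dvd)
    then show ?thesis using ij by (metis dvd_trans)
  qed
qed

text \<open>The ring is finite, so multiplication by a non-zero-divisor is injective, hence
  surjective, and attains 1.\<close>

lemma mod_ring_unit_iff:
  fixes r :: "'n::nontriv mod_ring"
  shows "r dvd 1 \<longleftrightarrow> (\<forall>z. r * z = 0 \<longrightarrow> z = 0)"
proof
  assume "r dvd 1"
  then obtain s where "1 = r * s" by blast
  then show "\<forall>z. r * z = 0 \<longrightarrow> z = 0"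
    by (metis mult.assoc mult.commute mult.right_neutral mult_zero_right)
next
  assume *: "\<forall>z. r * z = 0 \<longrightarrow> z = 0"
  have "inj ((*) r)"
  proof (rule injI)
    fix x y assume "r * x = r * y"
    then have "r * (x - y) = 0" by (simp add: algebra_simps)
    then show "x = y" using * by (metis eq_iff_diff_eq_0)
  qed
  then have "surj ((*) r)" by (simp add: finite_UNIV_inj_surj)
  then show "r dvd 1" by (metis dvdI surjD)
qed

section \<open>Admissible vectors and symplectic bases\<close>

lemma admissible_iff: "admissible v \<longleftrightarrow> (\<forall>u. zscale u v = 0 \<longrightarrow> u = 0)"
proof
  assume "admissible v"
  then show "\<forall>u. zscale u v = 0 \<longrightarrow> u = 0"
    unfolding admissible_def inj_def by (metis zmod.scale_zero_left)
next
  assume *: "\<forall>u. zscale u v = 0 \<longrightarrow> u = 0"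
  show "admissible v"
    unfolding admissible_def
  proof (rule injI)
    fix x y assume "zscale x v = zscale y v"
    then have "zscale (x - y) v = 0" by (simp add: zmod.scale_left_diff_distrib)
    then show "x = y" using * by (metis eq_iff_diff_eq_0)
  qed
qed

lemma sympl_add_right: "sympl v (w + w') = sympl v w + sympl v w'"
  and sympl_zscale_right: "sympl v (zscale u w) = u * sympl v w"
  and sympl_zscale_left: "sympl (zscale u v) w = u * sympl v w"
  and sympl_add_left: "sympl (v + v') w = sympl v w + sympl v' w"
  and sympl_self: "sympl v v = 0"
  by (auto simp: sympl_def zscale_def algebra_simps)

text \<open>Pairing \<open>zscale u v\<close> with \<open>h\<close> recovers the scalar
  \<open>u\<close>.\<close>

lemma admissibleI_sympl:
  assumes "sympl v h = 1"
  shows "admissible v"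
  unfolding admissible_iff
proof (intro allI impI)
  fix u assume "zscale u v = 0"
  then have "u * sympl v h = 0"
    by (metis sympl_zscale_left zmod.scale_zero_left mult_zero_left)
  then show "u = 0" using assms by simp
qed

text \<open>This is Cramer's rule: \<open>sympl g h\<close> is, up to sign, the determinant of the
  pair, and being 1 it need not be divided by.\<close>

lemma sympl_basis_expansion:
  assumes "sympl g h = 1"
  shows "w = zscale (sympl w h) g + zscale (sympl g w) h"
proof -
  obtain g1 g2 h1 h2 w1 w2 where [simp]: "g = (g1, g2)" "h = (h1, h2)" "w = (w1, w2)"
    by (metis surj_pair)
  have 1: "g2 * h1 - h2 * g1 = 1" using assms by (simp add: sympl_def)
  have "(w2 * h1 - h2 * w1) * g1 + (g2 * w1 - w2 * g1) * h1 = w1 * (g2 * h1 - h2 * g1)"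
    by (simp add: algebra_simps)
  moreover have "(w2 * h1 - h2 * w1) * g2 + (g2 * w1 - w2 * g1) * h2 = w2 * (g2 * h1 - h2 * g1)"
    by (simp add: algebra_simps)
  ultimately show ?thesis by (simp add: sympl_def zscale_def 1)
qed

section \<open>Points through a vector and its perp-set\<close>

lemma subspace_perp: "zmod.subspace (perp v)"
  by (rule zmod.subspaceI)
    (auto simp: perp_def sympl_add_right sympl_zscale_right sympl_def[of v 0])

lemma point_union_iff:
  "w \<in> point_union v \<longleftrightarrow> (\<exists>q s t. admissible q \<and> v = zscale s q \<and> w = zscale t q)"
  unfolding point_union_def proj_line_def cyclic_submodule_def by blast

lemma point_union_subset_perp: "point_union v \<subseteq> perp v"
  by (auto simp: point_union_iff perp_def sympl_zscale_left sympl_zscale_right sympl_self)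

text \<open>Take for \<open>r\<close> a coordinate of \<open>v\<close> that divides the other one.
  Then \<open>g\<close> has an entry 1, so a signed unit vector completes it to a symplectic
  basis.\<close>

lemma vector_multiple_of_basis:
  fixes v :: "'n::nontriv zvec"
  assumes total: "\<And>a b :: 'n mod_ring. a dvd b \<or> b dvd a"
  obtains r g h where "v = zscale r g" and "sympl g h = 1"
proof -
  consider k where "snd v = fst v * k" | k where "fst v = snd v * k"
    using total[of "fst v" "snd v"] by (auto elim: dvdE)
  then show ?thesis
  proof cases
    case 1
    show ?thesis
      by (rule that[of "fst v" "(1, k)" "(0, - 1)"])
        (use 1 in \<open>simp_all add: zscale_def sympl_def prod_eq_iff\<close>)
  next
    case 2
    show ?thesis
      by (rule that[of "snd v" "(k, 1)" "(1, 0)"])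
        (use 2 in \<open>simp_all add: zscale_def sympl_def prod_eq_iff\<close>)
  qed
qed

lemma admissible_zscale_iff:
  assumes "admissible g"
  shows "admissible (zscale r g) \<longleftrightarrow> r dvd 1"
  using assms unfolding admissible_iff mod_ring_unit_iff
  by (metis mult.commute zmod.scale_scale zmod.scale_zero_left)

lemma span_point_union:
  assumes v: "v = zscale r g" and gh: "sympl g h = 1"
  shows "zmod.span (point_union v) = perp v"
proof
  show "zmod.span (point_union v) \<subseteq> perp v"
    by (simp add: point_union_subset_perp subspace_perp zmod.span_minimal)
next
  show "perp v \<subseteq> zmod.span (point_union v)"
  proof
    fix w assume "w \<in> perp v"
    define \<beta> where "\<beta> = sympl g w"
    have r\<beta>: "r * \<beta> = 0"
      using \<open>w \<in> perp v\<close> by (simp add: perp_def v sympl_zscale_left \<beta>_def)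
    \<comment> \<open>Adding a multiple of \<open>h\<close> to \<open>g\<close> keeps the pairing
      with \<open>h\<close> equal to 1, and \<open>r * z = 0\<close> keeps the \<open>r\<close>-fold
      equal to \<open>v\<close>. The cases \<open>z = 0\<close> and \<open>z = \<beta>\<close> give
      \<open>g\<close> and, by subtraction, \<open>zscale \<beta> h\<close>.\<close>
    have mem: "g + zscale z h \<in> point_union v" if "r * z = 0" for z
    proof -
      have "sympl (g + zscale z h) h = 1"
        by (simp add: sympl_add_left sympl_zscale_left sympl_self gh)
      then have "admissible (g + zscale z h)" by (rule admissibleI_sympl)
      moreover have "v = zscale r (g + zscale z h)"
        using that by (simp add: v zmod.scale_right_distrib)
      ultimately show ?thesis
        unfolding point_union_iff by (metis zmod.scale_one)
    qed
    have g: "g \<in> zmod.span (point_union v)"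
      using mem[of 0] by (simp add: zmod.span_base)
    have "g + zscale \<beta> h \<in> zmod.span (point_union v)"
      using mem[OF r\<beta>] by (rule zmod.span_base)
    from zmod.span_diff[OF this g] have "zscale \<beta> h \<in> zmod.span (point_union v)"
      by simp
    with zmod.span_scale[OF g] have "zscale (sympl w h) g + zscale \<beta> h \<in> zmod.span (point_union v)"
      by (rule zmod.span_add)
    then show "w \<in> zmod.span (point_union v)"
      unfolding \<beta>_def sympl_basis_expansion[OF gh, symmetric] .
  qed
qed

lemma point_union_eq_perp_iff:
  fixes v :: "'n::nontriv zvec"
  assumes total: "\<And>a b :: 'n mod_ring. a dvd b \<or> b dvd a"
  shows "point_union v = perp v \<longleftrightarrow> v = 0 \<or> admissible v"
proof -
  obtain r g h where v: "v = zscale r g" and gh: "sympl g h = 1"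
    using vector_multiple_of_basis[OF total] by blast
  show ?thesis
  proof
    assume eq: "point_union v = perp v"
    show "v = 0 \<or> admissible v"
    proof (rule ccontr)
      assume "\<not> (v = 0 \<or> admissible v)"
      then have "v \<noteq> 0" and "\<not> r dvd 1"
        using admissible_zscale_iff[OF admissibleI_sympl[OF gh]] v by auto
      then have "r \<noteq> 0" using v by auto
      obtain z where z: "r * z = 0" "z \<noteq> 0"
        using \<open>\<not> r dvd 1\<close> unfolding mod_ring_unit_iff by blast
      have "zscale z h \<in> point_union v"
        unfolding eq perp_def using z gh
        by (simp add: v sympl_zscale_left sympl_zscale_right)
      then obtain q s t where "admissible q" and s: "v = zscale s q" and t: "zscale z h = zscale t q"
        unfolding point_union_iff by blast
      \<comment> \<open>These are the coordinates of \<open>q\<close> in the basis \<open>g\<close>,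
        \<open>h\<close>. Comparing coordinates in \<open>v = zscale s q\<close> and
        \<open>zscale z h = zscale t q\<close> gives the four equations below.\<close>
      define \<alpha> \<beta> where "\<alpha> = sympl q h" and "\<beta> = sympl g q"
      have q: "q = zscale \<alpha> g + zscale \<beta> h"
        unfolding \<alpha>_def \<beta>_def by (rule sympl_basis_expansion[OF gh])
      have "sympl v h = r" "sympl g v = 0"
        by (simp_all add: v sympl_zscale_left sympl_zscale_right gh sympl_self)
      then have r: "s * \<alpha> = r" "s * \<beta> = 0"
        by (simp_all add: s sympl_zscale_left sympl_zscale_right \<alpha>_def \<beta>_def)
      have "sympl (zscale z h) h = 0" "sympl g (zscale z h) = z"
        by (simp_all add: sympl_zscale_left sympl_zscale_right gh sympl_self)
      then have z': "t * \<alpha> = 0" "t * \<beta> = z"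
        by (simp_all add: t sympl_zscale_left sympl_zscale_right \<alpha>_def \<beta>_def)
      \<comment> \<open>A common divisor of both coordinates factors out of \<open>q\<close>;
        whatever annihilates it annihilates \<open>q\<close>, so admissibility makes it a unit. By
        totality, one of the two coordinates is such a common divisor.\<close>
      have unit: "x dvd 1" if "x dvd \<alpha>" "x dvd \<beta>" for x
      proof -
        obtain a b where ab: "\<alpha> = x * a" "\<beta> = x * b"
          using \<open>x dvd \<alpha>\<close> \<open>x dvd \<beta>\<close> by (auto elim!: dvdE)
        have "q = zscale x (zscale a g + zscale b h)"
          by (simp add: q ab zmod.scale_right_distrib)
        then have "\<forall>u. x * u = 0 \<longrightarrow> u = 0"
          using \<open>admissible q\<close> unfolding admissible_iff
          by (metis mult.commute zmod.scale_scale zmod.scale_zero_left)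
        then show ?thesis by (simp add: mod_ring_unit_iff)
      qed
      from total[of \<alpha> \<beta>] have "\<alpha> dvd 1 \<or> \<beta> dvd 1" using unit dvd_refl by metis
      then show False
      proof
        assume "\<alpha> dvd 1"
        then have "t = 0" using z' by (simp add: mod_ring_unit_iff mult.commute)
        then show False using z z' by simp
      next
        assume "\<beta> dvd 1"
        then have "s = 0" using r by (simp add: mod_ring_unit_iff mult.commute)
        then show False using \<open>r \<noteq> 0\<close> r by simp
      qed
    qed
  next
    assume "v = 0 \<or> admissible v"
    then have "perp v \<subseteq> point_union v"
    proof
      \<comment> \<open>The zero vector lies on every point, and every \<open>w\<close> is a
        multiple of some admissible \<open>q\<close>.\<close>
      assume "v = 0"
      show ?thesis
      proof
        fix w :: "'n zvec"
        obtain s q h' where w: "w = zscale s q" "sympl q h' = 1"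
          using vector_multiple_of_basis[OF total] by blast
        then show "w \<in> point_union v"
          unfolding point_union_iff \<open>v = 0\<close>
          by (metis admissibleI_sympl zmod.scale_zero_left)
      qed
    next
      assume adm: "admissible v"
      have g: "admissible g" using gh by (rule admissibleI_sympl)
      \<comment> \<open>Here \<open>r\<close> is a unit, so orthogonality to \<open>v\<close> forces
        the \<open>h\<close>-coordinate to vanish: \<open>perp v\<close> is contained in the single
        point generated by \<open>g\<close>.\<close>
      have unit: "\<forall>z. r * z = 0 \<longrightarrow> z = 0"
        using adm g admissible_zscale_iff mod_ring_unit_iff v by blast
      show ?thesis
      proof
        fix w assume "w \<in> perp v"
        then have "r * sympl g w = 0" by (simp add: perp_def v sympl_zscale_left)
        then have "sympl g w = 0" using unit by blast
        then have "w = zscale (sympl w h) g"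
          by (metis sympl_basis_expansion[OF gh] zmod.scale_zero_left add.right_neutral)
        then show "w \<in> point_union v"
          unfolding point_union_iff using g v by blast
      qed
    qed
    then show "point_union v = perp v" using point_union_subset_perp by blast
  qed
qed

lemma point_union_perp_prime_power:
  fixes v :: "'n::nontriv zvec"
  assumes "prime p" and "CARD('n) = p ^ e"
  shows "zmod.span (point_union v) = perp v \<and>
    (point_union v = perp v \<longleftrightarrow> v = 0 \<or> admissible v)"
proof -
  have total: "x dvd y \<or> y dvd x" for x y :: "'n mod_ring"
    using assms by (rule mod_ring_dvd_total)
  obtain r g h where "v = zscale r g" and "sympl g h = 1"
    using vector_multiple_of_basis[OF total] by blast
  then have "zmod.span (point_union v) = perp v" by (rule span_point_union)
  then show ?thesis using point_union_eq_perp_iff[OF total] by blast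
qed

theorem theorem3:
  fixes d p \<epsilon> :: nat
    and b c :: "'n::nontriv mod_ring"
  assumes "prime p" and "d = p ^ \<epsilon>" and "d > 1" and "CARD('n) = d"
  shows "zmod.span (point_union (b, c)) = perp (b, c) \<and>
    (point_union (b, c) = perp (b, c) \<longleftrightarrow> (b, c) = (0, 0) \<or> admissible (b, c))"
  using assms point_union_perp_prime_power[of p \<epsilon> "(b, c)"] by (simp add: zero_prod_def)

end
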